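(* Let $\mathcal{H}$ be a Hilbert space, let $\{f_k\}_{k=1}^\infty$ be a frame for $\mathcal{H}$ with bounds $A,B$, and let $\{g_k\}_{k=1}^\infty$ be a dual frame of $\{f_k\}_{k=1}^\infty$ with bounds $C,D$. Assume that $\{h_k\}_{k=1}^\infty$ is a sequence in $\mathcal{H}$ satisfying the following two conditions: (1) $\lambda:=\sum_{k=1}^\infty\|f_k-h_k\|^2<\infty$; (2) $\mu:=\sum_{k=1}^\infty\|f_k-h_k\|\,\|g_k\|<1$. Then $\{h_k\}_{k=1}^\infty$ is a frame for $\mathcal{H}$ with bounds $\frac{1}{D}(1-\mu)^2$ and $B\left(1+\frac{\sqrt{\lambda}}{\sqrt{B}}\right)^2$.
   Context: A sequence $\{f_k\}_{k=1}^\infty$ in a Hilbert space $\mathcal{H}$ is a frame for $\mathcal{H}$ with bounds $A,B$ (where $A,B>0$; $A$ is the lower and $B$ the upper bound) if $A\|f\|^2\le\sum_{k=1}^\infty|\langle f,f_k\rangle|^2\le B\|f\|^2$ for all $f\in\mathcal{H}$. A frame $\{g_k\}_{k=1}^\infty$ for $\mathcal{H}$ is called a dual frame of $\{f_k\}_{k=1}^\infty$ if $f=\sum_{k=1}^\infty\langle f,g_k\rangle f_k$ for all $f\in\mathcal{H}$. *)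

theory Defs
  imports "HOL-Analysis.Analysis"
begin

text \<open>
  Normed fields with a conjugation satisfying x * conj x = |x|^2. These axioms make x + conj x real
  (expand |x + 1|^2), so every element is a root of a real quadratic polynomial: up to isomorphism
  the only such fields are the real and the complex numbers. Hilbert spaces over both fields are
  treated at once in this way.
\<close>

class conj_field = real_normed_field +
  fixes conj :: "'a \<Rightarrow> 'a"
  assumes conj_add: "conj (x + y) = conj x + conj y"
    and conj_mult: "conj (x * y) = conj x * conj y"
    and conj_conj: "conj (conj x) = x"
    and mult_conj: "x * conj x = (norm x)\<^sup>2 *\<^sub>R 1"

instantiation real :: conj_field
begin
definition conj_real :: "real \<Rightarrow> real" where "conj_real x = x"
instance by standard (auto simp: conj_real_def power2_eq_square)
end

instantiation complex :: conj_field
begin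
definition conj_complex :: "complex \<Rightarrow> complex" where "conj_complex z = cnj z"
instance by standard
  (auto simp: conj_complex_def scaleR_conv_of_real complex_norm_square simp del: of_real_power)
end

text \<open>
  The carrier is a whole type. Completeness and the norm topology come from the class banach;
  the last assumption says that the norm is the one induced by the inner product, and in
  particular it makes the inner product positive definite. The inner product is linear in its
  first argument.
\<close>

locale hilbert_space = vector_space smul
  for smul :: "'k::conj_field \<Rightarrow> 'a::banach \<Rightarrow> 'a" +
  fixes ip :: "'a \<Rightarrow> 'a \<Rightarrow> 'k"
  assumes smul_of_real: "smul (of_real r) x = r *\<^sub>R x"
    and ip_add_left: "ip (x + y) z = ip x z + ip y z"
    and ip_smul_left: "ip (smul c x) y = c * ip x y"
    and ip_conj: "ip y x = conj (ip x y)"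
    and ip_self: "ip x x = of_real ((norm x)\<^sup>2)"

lemma hilbert_space_real_inner:
  "hilbert_space (scaleR :: real \<Rightarrow> 'a \<Rightarrow> 'a) (inner :: 'a::{real_inner,banach} \<Rightarrow> 'a \<Rightarrow> real)"
  by unfold_locales
    (auto simp: algebra_simps inner_commute conj_real_def power2_norm_eq_inner)

lemma hilbert_space_complex:
  "hilbert_space ((*) :: complex \<Rightarrow> complex \<Rightarrow> complex) (\<lambda>x y. x * cnj y)"
  by unfold_locales
    (auto simp: algebra_simps conj_complex_def scaleR_conv_of_real complex_norm_square
          simp del: of_real_power)

text \<open>
  Sequences are indexed by nat, starting at 0 instead of 1. Summability is required explicitly,
  because suminf of a divergent series is an unspecified value.
\<close>

definition frame_with_bounds ::
    "('a::real_normed_vector \<Rightarrow> 'a \<Rightarrow> 'k::real_normed_vector) \<Rightarrow> (nat \<Rightarrow> 'a) \<Rightarrow> real \<Rightarrow> real \<Rightarrow> bool"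
  where "frame_with_bounds ip f A B \<longleftrightarrow> A > 0 \<and> B > 0 \<and>
    (\<forall>x. summable (\<lambda>k. (norm (ip x (f k)))\<^sup>2) \<and>
         A * (norm x)\<^sup>2 \<le> (\<Sum>k. (norm (ip x (f k)))\<^sup>2) \<and>
         (\<Sum>k. (norm (ip x (f k)))\<^sup>2) \<le> B * (norm x)\<^sup>2)"

definition is_frame ::
    "('a::real_normed_vector \<Rightarrow> 'a \<Rightarrow> 'k::real_normed_vector) \<Rightarrow> (nat \<Rightarrow> 'a) \<Rightarrow> bool"
  where "is_frame ip f \<longleftrightarrow> (\<exists>A B. frame_with_bounds ip f A B)"

definition is_dual_frame ::
    "('k::real_normed_vector \<Rightarrow> 'a \<Rightarrow> 'a) \<Rightarrow> ('a::real_normed_vector \<Rightarrow> 'a \<Rightarrow> 'k) \<Rightarrow>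
      (nat \<Rightarrow> 'a) \<Rightarrow> (nat \<Rightarrow> 'a) \<Rightarrow> bool"
  where "is_dual_frame smul ip f g \<longleftrightarrow>
    is_frame ip g \<and> (\<forall>x. (\<lambda>k. smul (ip x (g k)) (f k)) sums x)"

end

theory Submission
  imports Defs
begin

text \<open>
  The upper bound is Minkowski's inequality in l2. For the lower bound no inversion of the
  perturbed reconstruction operator U x = \<Sum> \<langle>x, g k\<rangle> h k is needed: from
  \<parallel>x - U x\<parallel> \<le> \<mu> \<parallel>x\<parallel> one gets
  (1 - \<mu>) \<parallel>x\<parallel>^2 \<le> |\<langle>U x, x\<rangle>|, and Cauchy-Schwarz in l2 bounds the right-hand side by
  sqrt D \<parallel>x\<parallel> times the l2 norm of \<langle>x, h k\<rangle>. The estimates are carried out for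
  partial sums, and the only limit needed is that of the expansion of x in the f k.
\<close>

lemma conj_zero: "conj (0 :: 'k::conj_field) = 0"
  using conj_add[of "0::'k" 0] by simp

text \<open>Taking norms in \<open>mult_conj\<close> gives |x| |conj x| = |x|^2, and a nonzero |x|
  cancels.\<close>

lemma norm_conj: "norm (conj x) = norm (x :: 'k::conj_field)"
proof (cases "x = 0")
  case False
  have "norm x * norm (conj x) = norm x * norm x"
    using arg_cong[OF mult_conj[of x], of norm] by (simp add: norm_mult power2_eq_square)
  then show ?thesis using False by simp
qed (simp add: conj_zero)

context hilbert_space
begin

lemma ip_zero_left [simp]: "ip 0 y = 0"
  using ip_add_left[of 0 0 y] by simp

lemma ip_minus_left: "ip (- x) y = - ip x y"
  using ip_add_left[of x "- x" y] by (simp add: eq_neg_iff_add_eq_0 add.commute)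

lemma ip_diff_left: "ip (x - y) z = ip x z - ip y z"
  using ip_add_left[of x "- y" z] by (simp add: ip_minus_left)

lemma ip_add_right: "ip x (y + z) = ip x y + ip x z"
  by (metis ip_conj ip_add_left conj_add)

lemma ip_diff_right: "ip x (y - z) = ip x y - ip x z"
  using ip_add_right[of x "y - z" z] by simp

lemma ip_smul_right: "ip x (smul c y) = conj c * ip x y"
  by (metis ip_conj ip_smul_left conj_mult)

lemma ip_sum_left: "ip (sum u S) y = (\<Sum>k\<in>S. ip (u k) y)"
  by (induction S rule: infinite_finite_induct) (auto simp: ip_add_left)

lemma norm_ip_commute: "norm (ip x y) = norm (ip y x)"
  by (metis ip_conj norm_conj)

text \<open>The locale ties \<open>smul\<close> to the norm only through real scalars. For general
  scalars homogeneity comes from the inner product: \<langle>cx, cx\<rangle> = c (conj c)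
  \<langle>x, x\<rangle>, and \<open>conj\<close> preserves the norm.\<close>

lemma norm_smul: "norm (smul c x) = norm c * norm x"
proof -
  have "norm (ip (smul c x) (smul c x)) = norm (c * (conj c * ip x x))"
    by (subst ip_smul_left, subst ip_smul_right) (rule refl)
  then have "(norm (smul c x))\<^sup>2 = (norm c * norm x)\<^sup>2"
    unfolding norm_mult norm_conj ip_self norm_of_real by (simp add: power2_eq_square mult_ac)
  then show ?thesis by simp
qed

lemma Cauchy_Schwarz: "norm (ip x y) \<le> norm x * norm y"
proof (cases "y = 0")
  case True
  then show ?thesis using norm_ip_commute[of x y] by simp
next
  case False
  define n where "n = ip y y"
  define c where "c = ip x y"
  \<comment> \<open>Up to the factor \<open>n\<close>, this is the component of x orthogonal to y;
    scaling by \<open>n\<close> avoids a division in the field.\<close>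
  define z where "z = smul n x - smul c y"
  have conj_n: "conj n = n" unfolding n_def by (rule ip_conj[symmetric])
  have zl: "ip z w = n * ip x w - c * ip y w" for w
    by (simp add: z_def ip_diff_left ip_smul_left)
  have "ip z y = 0" by (simp add: zl n_def c_def)
  then have "ip z z = n * ip z x"
    by (subst (2) z_def) (simp add: ip_diff_right ip_smul_right conj_n)
  also have "\<dots> = n * (n * ip x x - c * conj c)"
    by (simp add: zl c_def ip_conj[of y x])
  \<comment> \<open>All factors are images of reals, so the identity can be pulled back along the
    injective \<open>of_real\<close> to the reals, where an order is available.\<close>
  also have "\<dots> = of_real ((norm y)\<^sup>2 * ((norm y)\<^sup>2 * (norm x)\<^sup>2 - (norm c)\<^sup>2))"
    unfolding n_def ip_self mult_conj by (simp add: scaleR_conv_of_real)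
  finally have "(norm z)\<^sup>2 = (norm y)\<^sup>2 * ((norm y)\<^sup>2 * (norm x)\<^sup>2 - (norm c)\<^sup>2)"
    unfolding ip_self of_real_eq_iff .
  then have "0 \<le> (norm y)\<^sup>2 * ((norm y)\<^sup>2 * (norm x)\<^sup>2 - (norm c)\<^sup>2)"
    by (metis zero_le_power2)
  then have "(norm c)\<^sup>2 \<le> (norm x * norm y)\<^sup>2"
    using False by (simp add: zero_le_mult_iff power_mult_distrib mult.commute)
  then show ?thesis unfolding c_def by (simp add: power2_le_iff_abs_le)
qed

end

lemma L2_set_le_sqrt_suminf:
  fixes u :: "nat \<Rightarrow> real"
  assumes "summable (\<lambda>k. (u k)\<^sup>2)" "finite S"
  shows "L2_set u S \<le> sqrt (\<Sum>k. (u k)\<^sup>2)"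
  unfolding L2_set_def using assms by (auto intro!: sum_le_suminf)

text \<open>Passes from finite sections to the whole series: partial sums of nonnegative terms
  increase, so a bound uniform in n gives both convergence and the same bound on the sum.\<close>

lemma summable_of_L2_set_bound:
  fixes u :: "nat \<Rightarrow> real"
  assumes "\<And>n. L2_set u {..<n} \<le> M"
  shows "summable (\<lambda>k. (u k)\<^sup>2)" and "(\<Sum>k. (u k)\<^sup>2) \<le> M\<^sup>2"
proof -
  have bound: "(\<Sum>k<n. (u k)\<^sup>2) \<le> M\<^sup>2" for n
    using power_mono[OF assms[of n], of 2] by (simp add: L2_set_def sum_nonneg)
  show "summable (\<lambda>k. (u k)\<^sup>2)"
    by (rule summableI_nonneg_bounded[OF _ bound]) simp
  then show "(\<Sum>k. (u k)\<^sup>2) \<le> M\<^sup>2"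
    by (rule suminf_le_const) (rule bound)
qed

lemma L2_set_frame_le:
  assumes "frame_with_bounds ip f A B"
  shows "L2_set (\<lambda>k. norm (ip x (f k))) {..<n::nat} \<le> sqrt B * norm x"
proof -
  have "L2_set (\<lambda>k. norm (ip x (f k))) {..<n} \<le> sqrt (\<Sum>k. (norm (ip x (f k)))\<^sup>2)"
    using assms by (intro L2_set_le_sqrt_suminf) (auto simp: frame_with_bounds_def)
  also have "\<dots> \<le> sqrt (B * (norm x)\<^sup>2)"
    using assms by (simp add: frame_with_bounds_def)
  finally show ?thesis by (simp add: real_sqrt_mult)
qed

context hilbert_space
begin

text \<open>Split \<open>h k\<close> as \<open>f k - (f k - h k)\<close>: the first part is
  controlled by the upper frame bound, the second by Cauchy-Schwarz and \<open>lam\<close>.\<close>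

lemma L2_set_perturbed_le:
  assumes f: "frame_with_bounds ip f A B"
    and lam: "(\<lambda>k. (norm (f k - h k))\<^sup>2) sums lam"
  shows "L2_set (\<lambda>k. norm (ip x (h k))) {..<n} \<le> (sqrt B + sqrt lam) * norm x"
proof -
  have "L2_set (\<lambda>k. norm (ip x (h k))) {..<n}
      \<le> L2_set (\<lambda>k. norm (ip x (f k)) + norm x * norm (f k - h k)) {..<n}"
  proof (rule L2_set_mono)
    fix k
    have "ip x (h k) = ip x (f k) - ip x (f k - h k)" by (simp add: ip_diff_right)
    then show "norm (ip x (h k)) \<le> norm (ip x (f k)) + norm x * norm (f k - h k)"
      using norm_triangle_ineq4[of "ip x (f k)" "ip x (f k - h k)"]
        Cauchy_Schwarz[of x "f k - h k"] by simp
  qed simp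
  also have "\<dots> \<le> L2_set (\<lambda>k. norm (ip x (f k))) {..<n}
      + L2_set (\<lambda>k. norm x * norm (f k - h k)) {..<n}"
    by (rule L2_set_triangle_ineq)
  also have "L2_set (\<lambda>k. norm x * norm (f k - h k)) {..<n}
      = norm x * L2_set (\<lambda>k. norm (f k - h k)) {..<n}"
    by (simp add: L2_set_right_distrib)
  also have "L2_set (\<lambda>k. norm (f k - h k)) {..<n} \<le> sqrt lam"
    using L2_set_le_sqrt_suminf[of "\<lambda>k. norm (f k - h k)" "{..<n}"] lam
    by (simp add: sums_iff)
  finally have "L2_set (\<lambda>k. norm (ip x (h k))) {..<n}
      \<le> L2_set (\<lambda>k. norm (ip x (f k))) {..<n} + norm x * sqrt lam"
    by (simp add: mult_left_mono)
  then show ?thesis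
    using L2_set_frame_le[OF f, of x n] by (simp add: algebra_simps)
qed

lemma perturbed_dual_lower_bound:
  assumes g: "frame_with_bounds ip g C D"
    and dual: "(\<lambda>k. smul (ip x (g k)) (f k)) sums x"
    and mu: "(\<lambda>k. norm (f k - h k) * norm (g k)) sums \<mu>"
    and h: "summable (\<lambda>k. (norm (ip x (h k)))\<^sup>2)"
  shows "(1 - \<mu>) * norm x \<le> sqrt D * sqrt (\<Sum>k. (norm (ip x (h k)))\<^sup>2)"
    (is "_ \<le> sqrt D * ?H")
proof (cases "x = 0")
  case False
  define T where "T n = (\<Sum>k<n. smul (ip x (g k)) (f k))" for n
  define S where "S n = (\<Sum>k<n. smul (ip x (g k)) (h k))" for n
  \<comment> \<open>Since |\<langle>x, g k\<rangle>| is at most |x| |g k|, each term is dominated by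
    |x| times a term of the series for \<mu>, whence a bound independent of n.\<close>
  have TS: "norm (T n - S n) \<le> \<mu> * norm x" for n
  proof -
    have "T n - S n = (\<Sum>k<n. smul (ip x (g k)) (f k - h k))"
      by (simp add: T_def S_def sum_subtractf scale_right_diff_distrib)
    also have "norm \<dots> \<le> (\<Sum>k<n. norm (f k - h k) * norm (g k) * norm x)"
    proof (rule sum_norm_le)
      fix k
      show "norm (smul (ip x (g k)) (f k - h k)) \<le> norm (f k - h k) * norm (g k) * norm x"
        using mult_right_mono[OF Cauchy_Schwarz[of x "g k"] norm_ge_zero[of "f k - h k"]]
        by (simp add: norm_smul mult_ac)
    qed
    also have "\<dots> \<le> \<mu> * norm x"
      unfolding sum_distrib_right[symmetric]
      using sum_le_suminf[of "\<lambda>k. norm (f k - h k) * norm (g k)" "{..<n}"] mu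
      by (intro mult_right_mono) (auto simp: sums_iff)
    finally show ?thesis .
  qed
  \<comment> \<open>Here D enters: \<langle>S n, x\<rangle> pairs the coefficients \<langle>x, g
    k\<rangle> with \<langle>h k, x\<rangle>, and the upper bound of g controls the former.\<close>
  have S: "norm (ip (S n) x) \<le> sqrt D * norm x * ?H" for n
  proof -
    have "norm (ip (S n) x) \<le> (\<Sum>k<n. norm (ip x (g k)) * norm (ip x (h k)))"
      unfolding S_def ip_sum_left ip_smul_left
      by (rule sum_norm_le) (simp add: norm_mult norm_ip_commute[of x "h _"])
    also have "\<dots> \<le> L2_set (\<lambda>k. norm (ip x (g k))) {..<n} * L2_set (\<lambda>k. norm (ip x (h k))) {..<n}"
      using L2_set_mult_ineq[of "\<lambda>k. norm (ip x (g k))" "\<lambda>k. norm (ip x (h k))" "{..<n}"] by simp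
    also have "\<dots> \<le> (sqrt D * norm x) * ?H"
      using L2_set_frame_le[OF g, of x n] L2_set_le_sqrt_suminf[OF h, of "{..<n}"]
      by (intro mult_mono') auto
    finally show ?thesis .
  qed
  have "(norm x)\<^sup>2 \<le> norm (x - T n) * norm x + \<mu> * norm x * norm x + sqrt D * norm x * ?H" for n
  proof -
    have "ip x x = ip (x - T n) x + ip (T n - S n) x + ip (S n) x"
      by (simp add: ip_diff_left)
    then have "(norm x)\<^sup>2 = norm (ip (x - T n) x + ip (T n - S n) x + ip (S n) x)"
      using ip_self[of x] by (metis norm_of_real abs_of_nonneg zero_le_power2)
    also have "\<dots> \<le> norm (ip (x - T n) x) + norm (ip (T n - S n) x) + norm (ip (S n) x)"
      by (meson norm_triangle_le order_refl norm_triangle_ineq add_right_mono order_trans)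
    also have "\<dots> \<le> norm (x - T n) * norm x + norm (T n - S n) * norm x + sqrt D * norm x * ?H"
      by (intro add_mono Cauchy_Schwarz S)
    also have "\<dots> \<le> norm (x - T n) * norm x + \<mu> * norm x * norm x + sqrt D * norm x * ?H"
      using TS[of n] by (simp add: mult_right_mono)
    finally show ?thesis .
  qed
  \<comment> \<open>Only the first summand depends on n, and it tends to 0 because the dual
    expansion makes \<open>T n\<close> converge to x.\<close>
  moreover have "(\<lambda>n. norm (x - T n) * norm x + \<mu> * norm x * norm x + sqrt D * norm x * ?H)
      \<longlonglongrightarrow> norm (x - x) * norm x + \<mu> * norm x * norm x + sqrt D * norm x * ?H"
    using dual unfolding T_def sums_def by (intro tendsto_intros)
  ultimately have "(norm x)\<^sup>2 \<le> norm (x - x) * norm x + \<mu> * norm x * norm x + sqrt D * norm x * ?H"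
    by (intro LIMSEQ_le_const) auto
  \<comment> \<open>The \<mu> term moves to the left, and a common factor \<open>norm x\<close> is
    left to cancel, which is why x = 0 is treated apart.\<close>
  then have "norm x * ((1 - \<mu>) * norm x) \<le> norm x * (sqrt D * ?H)"
    by (simp add: power2_eq_square algebra_simps)
  then show ?thesis using False by simp
qed (use g h in \<open>auto simp: frame_with_bounds_def intro!: mult_nonneg_nonneg suminf_nonneg\<close>)

end

theorem theorem2p1:
  fixes smul :: "'k::conj_field \<Rightarrow> 'a::banach \<Rightarrow> 'a"
    and ip :: "'a \<Rightarrow> 'a \<Rightarrow> 'k"
    and f g h :: "nat \<Rightarrow> 'a"
    and A B C D lam \<mu> :: real
  assumes "hilbert_space smul ip"
    and "frame_with_bounds ip f A B"
    and "is_dual_frame smul ip f g"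
    and "frame_with_bounds ip g C D"
    and "(\<lambda>k. (norm (f k - h k))\<^sup>2) sums lam"
    and "(\<lambda>k. norm (f k - h k) * norm (g k)) sums \<mu>"
    and "\<mu> < 1"
  shows "frame_with_bounds ip h (1 / D * (1 - \<mu>)\<^sup>2) (B * (1 + sqrt lam / sqrt B)\<^sup>2)"
proof -
  interpret hilbert_space smul ip by fact
  have B: "B > 0" and D: "D > 0" using assms(2,4) by (auto simp: frame_with_bounds_def)
  have lam: "lam \<ge> 0" using assms(5) by (auto simp: sums_iff intro!: suminf_nonneg)
  \<comment> \<open>Absorbing B into the square turns the stated bound into the constant that
    Minkowski's inequality yields.\<close>
  have upper: "B * (1 + sqrt lam / sqrt B)\<^sup>2 = (sqrt B + sqrt lam)\<^sup>2"
  proof -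
    have "B * (1 + sqrt lam / sqrt B)\<^sup>2 = (sqrt B * (1 + sqrt lam / sqrt B))\<^sup>2"
      using B by (simp add: power_mult_distrib)
    then show ?thesis using B by (simp add: distrib_left)
  qed
  show ?thesis
    unfolding frame_with_bounds_def upper
  proof (intro conjI allI)
    show "1 / D * (1 - \<mu>)\<^sup>2 > 0" using D assms(7) by simp
    show "(sqrt B + sqrt lam)\<^sup>2 > 0"
      using B lam by (intro zero_less_power add_pos_nonneg) auto
  next
    fix x
    let ?H = "\<Sum>k. (norm (ip x (h k)))\<^sup>2"
    note h = summable_of_L2_set_bound[OF L2_set_perturbed_le[OF assms(2,5), of x]]
    show summ: "summable (\<lambda>k. (norm (ip x (h k)))\<^sup>2)" by (rule h)
    show "?H \<le> (sqrt B + sqrt lam)\<^sup>2 * (norm x)\<^sup>2"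
      using h(2) by (simp add: power_mult_distrib)
    have dual: "(\<lambda>k. smul (ip x (g k)) (f k)) sums x"
      using assms(3) by (simp add: is_dual_frame_def)
    \<comment> \<open>Squaring keeps the inequality because \<mu> < 1 makes the left-hand side
      nonnegative.\<close>
    have "((1 - \<mu>) * norm x)\<^sup>2 \<le> (sqrt D * sqrt ?H)\<^sup>2"
      using perturbed_dual_lower_bound[OF assms(4) dual assms(6) summ] assms(7)
      by (intro power_mono) auto
    then have "(1 - \<mu>)\<^sup>2 * (norm x)\<^sup>2 \<le> D * ?H"
      using D suminf_nonneg[OF summ] by (simp add: power_mult_distrib)
    then show "1 / D * (1 - \<mu>)\<^sup>2 * (norm x)\<^sup>2 \<le> ?H"
      using D by (simp add: field_simps)
  qed
qed

end
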